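(* Let $X$ be a separable metrizable topological space, let $f\subseteq X^2$ be a $V$-relation on $X$ satisfying condition $\Gamma$, and let $\langle P,\leq\rangle$ be a partial order. Then the Mahavier product $\mathbf{M}\langle X,f,P\rangle$ is separable metrizable if and only if $P$ is countable.
   Context: A relation $f\subseteq X^2$ is treated as a set-valued function: $f(x)=\{y:\langle x,y\rangle\in f\}$, and $f(A)=\bigcup_{x\in A}f(x)$ for $A\subseteq X$. A relation $f\subseteq X^2$ is a $V$-relation if it is closed (as a subset of $X^2$), idempotent ($f(f(x))=f(x)$ for all $x\in X$), surjective (for every $y\in X$ there is $x\in X$ with $y\in f(x)$), and serial (for every $x\in X$ there is $y\in X$ with $y\in f(x)$). The relation $f$ satisfies condition $\Gamma$ if there exist distinct $x,y\in X$ such that $\langle x,x\rangle,\langle x,y\rangle,\langle y,y\rangle\in f$. A partial order is a set with a reflexive, transitive, antisymmetric relation. The Mahavier product is $\mathbf{M}\langle X,f,P\rangle=\{x\in X^P: x(p)\in f(x(q))\text{ for all }p\leq q\}$, with the subspace topology from the Tychonoff product $X^P$. Countable means finite or countably infinite. *)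

theory Defs
  imports "HOL-Analysis.Analysis"
begin

text \<open>
  A relation \<open>f\<close> on the carrier of \<open>X\<close> is read as the set-valued function with values
  \<open>f `` {x}\<close> at a point and \<open>f `` A\<close> on a set. A topology need not have the whole type as its
  carrier, so points are relativised to \<^term>\<open>topspace X\<close>.
\<close>

text \<open>\<^const>\<open>closedin\<close> also supplies \<open>f \<subseteq> topspace X \<times> topspace X\<close>.\<close>

definition V_relation :: "'a topology \<Rightarrow> ('a \<times> 'a) set \<Rightarrow> bool" where
  "V_relation X f \<longleftrightarrow>
     closedin (prod_topology X X) f \<and>
     (\<forall>x\<in>topspace X. f `` (f `` {x}) = f `` {x}) \<and>
     (\<forall>y\<in>topspace X. \<exists>x\<in>topspace X. y \<in> f `` {x}) \<and>
     (\<forall>x\<in>topspace X. \<exists>y\<in>topspace X. y \<in> f `` {x})"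

definition condition_Gamma :: "'a topology \<Rightarrow> ('a \<times> 'a) set \<Rightarrow> bool" where
  "condition_Gamma X f \<longleftrightarrow>
     (\<exists>x\<in>topspace X. \<exists>y\<in>topspace X. x \<noteq> y \<and> (x, x) \<in> f \<and> (x, y) \<in> f \<and> (y, y) \<in> f)"

text \<open>
  The order is a set of pairs: \<open>(p, q) \<in> le\<close> means \<open>p \<le> q\<close>. As in \<^const>\<open>product_topology\<close>,
  the elements of \<open>X\<^sup>P\<close> are the functions on \<open>P\<close> that are extensional (\<^const>\<open>undefined\<close>
  outside \<open>P\<close>).
\<close>

definition mahavier_set ::
  "'a topology \<Rightarrow> ('a \<times> 'a) set \<Rightarrow> 'p set \<Rightarrow> ('p \<times> 'p) set \<Rightarrow> ('p \<Rightarrow> 'a) set" where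
  "mahavier_set X f P le =
     {x \<in> P \<rightarrow>\<^sub>E topspace X. \<forall>p\<in>P. \<forall>q\<in>P. (p, q) \<in> le \<longrightarrow> x p \<in> f `` {x q}}"

definition mahavier_product ::
  "'a topology \<Rightarrow> ('a \<times> 'a) set \<Rightarrow> 'p set \<Rightarrow> ('p \<times> 'p) set \<Rightarrow> ('p \<Rightarrow> 'a) topology" where
  "mahavier_product X f P le =
     subtopology (product_topology (\<lambda>_. X) P) (mahavier_set X f P le)"

end

theory Submission
  imports Defs
begin

text \<open>
  If \<open>P\<close> is uncountable, condition \<open>\<Gamma>\<close> with witnesses \<open>x \<noteq> y\<close> yields the points \<open>z\<^sub>p\<close> of the
  Mahavier product with value \<open>y\<close> on the principal down-set of \<open>p\<close> and \<open>x\<close> elsewhere. Let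
  \<open>O\<^sub>p\<close> be the open set of points whose \<open>p\<close>-th coordinate avoids \<open>x\<close>; then \<open>z\<^sub>p \<in> O\<^sub>q\<close> iff
  \<open>q \<le> p\<close>. Choose a basic set \<open>B\<^sub>p\<close> with \<open>z\<^sub>p \<in> B\<^sub>p \<subseteq> O\<^sub>p\<close>. If \<open>B\<^sub>p = B\<^sub>q\<close> then
  \<open>p \<le> q\<close> and \<open>q \<le> p\<close>, so \<open>p \<mapsto> B\<^sub>p\<close> is injective and no base is countable.
\<close>

text \<open>The balls of radius \<open>1/(n+1)\<close> about the points of a countable dense set
  form a countable base.\<close>

lemma metrizable_separable_imp_second_countable:
  assumes "metrizable_space X" "separable_space X"
  shows "second_countable X"
proof -
  obtain M d where "Metric_space M d" and X: "X = Metric_space.mtopology M d"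
    using assms(1) metrizable_space_def by blast
  then interpret Metric_space M d by simp
  obtain C where C: "countable C" "C \<subseteq> M" "mtopology closure_of C = M"
    using assms(2) by (auto simp: separable_space_def X)
  define \<B> where "\<B> = (\<lambda>(c, n). mball c (inverse (real (Suc n)))) ` (C \<times> UNIV)"
  have "\<exists>V\<in>\<B>. x \<in> V \<and> V \<subseteq> U" if U: "openin mtopology U" "x \<in> U" for U x
  proof -
    obtain r where r: "r > 0" "mball x r \<subseteq> U"
      using U openin_mtopology by blast
    have "x \<in> M"
      using U openin_mtopology by blast
    \<comment> \<open>Half of \<open>r\<close>: a ball of this radius about a centre
      \<open>c\<close> this close to \<open>x\<close> contains \<open>x\<close> and, by the triangle
      inequality, stays inside the ball of radius \<open>r\<close>.\<close>
    obtain n where n: "inverse (real (Suc n)) < r / 2"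
      using r reals_Archimedean[of "r / 2"] by auto
    obtain c where c: "c \<in> C" "c \<in> mball x (inverse (real (Suc n)))"
    proof -
      have "x \<in> mtopology closure_of C"
        using C(3) \<open>x \<in> M\<close> by simp
      moreover have "inverse (real (Suc n)) > 0"
        by simp
      ultimately show ?thesis
        using that unfolding metric_closure_of by blast
    qed
    have "mball c (inverse (real (Suc n))) \<subseteq> mball x r"
      using c n by (intro mball_subset) (auto simp: commute)
    then show ?thesis
      using c r \<open>x \<in> M\<close> unfolding \<B>_def
      by (intro bexI[of _ "mball c (inverse (real (Suc n)))"]) (auto simp: commute)
  qed
  moreover have "countable \<B>"
    using C(1) by (simp add: \<B>_def)
  moreover have "\<forall>V\<in>\<B>. openin mtopology V"
    by (auto simp: \<B>_def)
  ultimately show ?thesis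
    unfolding second_countable_def X by blast
qed

text \<open>Finitely many constraints, each placing one coordinate in a member of that factor's
  countable base, cut out a basic open set, and there are only countably many finite lists of
  constraints.\<close>

lemma second_countable_product_topology:
  assumes "countable I" "\<And>i. i \<in> I \<Longrightarrow> second_countable (X i)"
  shows "second_countable (product_topology X I)"
proof -
  obtain \<B> where \<B>: "\<And>i. i \<in> I \<Longrightarrow> countable (\<B> i)"
      "\<And>i V. \<lbrakk>i \<in> I; V \<in> \<B> i\<rbrakk> \<Longrightarrow> openin (X i) V"
      "\<And>i U x. \<lbrakk>i \<in> I; openin (X i) U; x \<in> U\<rbrakk> \<Longrightarrow> \<exists>V\<in>\<B> i. x \<in> V \<and> V \<subseteq> U"
    using assms(2) unfolding second_countable_def by metis
  let ?T = "topspace (product_topology X I)"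
  \<comment> \<open>Lists make openness an induction: the empty list gives the whole product, and
    each entry intersects with one open coordinate preimage.\<close>
  define box where "box L = {x \<in> ?T. \<forall>(i, V) \<in> set L. x i \<in> V}" for L :: "('a \<times> 'b set) list"
  have "countable (box ` lists (Sigma I \<B>))"
    using assms(1) \<B>(1) by (intro countable_image countable_lists countable_SIGMA) auto
  moreover have "openin (product_topology X I) (box L)" if "L \<in> lists (Sigma I \<B>)" for L
    using that
  proof (induction L)
    case Nil
    then show ?case by (simp add: box_def flip: topspace_product_topology)
  next
    case (Cons a L)
    obtain i V where a: "a = (i, V)" by fastforce
    have "openin (product_topology X I) {x \<in> ?T. x i \<in> V}"
      using Cons.hyps a \<B>(2)
      by (intro openin_continuous_map_preimage[OF continuous_map_product_projection]) auto
    moreover have "box (a # L) = {x \<in> ?T. x i \<in> V} \<inter> box L"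
      by (auto simp: box_def a)
    ultimately show ?case
      using Cons.IH by auto
  qed
  moreover have "\<exists>W\<in>box ` lists (Sigma I \<B>). x \<in> W \<and> W \<subseteq> U"
    if U: "openin (product_topology X I) U" "x \<in> U" for U x
  proof -
    obtain V where V: "finite {i \<in> I. V i \<noteq> topspace (X i)}" "\<forall>i\<in>I. openin (X i) (V i)"
        "x \<in> Pi\<^sub>E I V" "Pi\<^sub>E I V \<subseteq> U"
      using U unfolding openin_product_topology_alt by blast
    \<comment> \<open>Only these finitely many coordinates need a constraint; elsewhere
      \<open>V i\<close> is the whole factor.\<close>
    let ?J = "{i \<in> I. V i \<noteq> topspace (X i)}"
    have "\<forall>i\<in>I. \<exists>W\<in>\<B> i. x i \<in> W \<and> W \<subseteq> V i"
      using V \<B>(3) by (meson PiE_mem)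
    then obtain b where b: "\<And>i. i \<in> I \<Longrightarrow> b i \<in> \<B> i \<and> x i \<in> b i \<and> b i \<subseteq> V i"
      by metis
    obtain L where L: "set L = (\<lambda>i. (i, b i)) ` ?J"
      using finite_list[OF finite_imageI[OF V(1)]] by metis
    have "x \<in> ?T"
      using U openin_subset by (meson subsetD)
    then have "x \<in> box L"
      using b L by (auto simp: box_def)
    moreover have "box L \<subseteq> Pi\<^sub>E I V"
    proof
      fix z assume z: "z \<in> box L"
      have "z i \<in> V i" if "i \<in> I" for i
      proof (cases "i \<in> ?J")
        case True
        then have "z i \<in> b i"
          using z L by (auto simp: box_def)
        then show ?thesis
          using b that by blast
      next
        case False
        then show ?thesis
          using z that by (auto simp: box_def)
      qed
      then show "z \<in> Pi\<^sub>E I V"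
        using z by (auto simp: box_def PiE_iff)
    qed
    moreover have "L \<in> lists (Sigma I \<B>)"
      using L b by auto
    ultimately show ?thesis
      using V(4) by blast
  qed
  ultimately show ?thesis
    unfolding second_countable_def by blast
qed

lemma second_countable_mahavier_product_imp_countable:
  assumes "t1_space X" "condition_Gamma X f" "partial_order_on P le"
    and "second_countable (mahavier_product X f P le)"
  shows "countable P"
proof -
  let ?M = "mahavier_product X f P le"
  obtain x y where xy: "x \<in> topspace X" "y \<in> topspace X" "x \<noteq> y"
      "(x, x) \<in> f" "(x, y) \<in> f" "(y, y) \<in> f"
    using assms(2) unfolding condition_Gamma_def by blast
  have refl: "\<And>p. p \<in> P \<Longrightarrow> (p, p) \<in> le" and "trans le" and "antisym le"
    using assms(3) by (auto simp: partial_order_on_def preorder_on_def refl_on_def)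
  define z where "z p = (\<lambda>q\<in>P. if (q, p) \<in> le then y else x)" for p
  define Om where "Om p = {m \<in> topspace ?M. m p \<in> topspace X - {x}}" for p
  have top: "topspace ?M = mahavier_set X f P le"
    by (auto simp: mahavier_product_def mahavier_set_def)
  \<comment> \<open>For \<open>r \<le> q\<close> the pair \<open>(z p q, z p r)\<close> must lie in
    \<open>f\<close>. If \<open>z p q = y\<close> then \<open>q \<le> p\<close>, so
    \<open>r \<le> p\<close> by transitivity and \<open>z p r = y\<close>. Hence
    \<open>(y, x)\<close>, which \<open>condition_Gamma\<close> does not provide, never
    occurs.\<close>
  have z: "z p \<in> topspace ?M" for p
    using xy \<open>trans le\<close> by (auto simp: top mahavier_set_def z_def dest: transD)
  have "openin ?M (Om p)" if "p \<in> P" for p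
    unfolding Om_def
  proof (rule openin_continuous_map_preimage)
    show "continuous_map ?M X (\<lambda>m. m p)"
      unfolding mahavier_product_def
      using that by (intro continuous_map_from_subtopology continuous_map_product_projection)
    show "openin X (topspace X - {x})"
      using assms(1) xy by (simp add: openin_diff closedin_t1_singleton)
  qed
  moreover have zO: "z p \<in> Om q \<longleftrightarrow> (q, p) \<in> le" if "q \<in> P" for p q
    using xy z that by (auto simp: Om_def z_def)
  moreover obtain \<B> where \<B>: "countable \<B>"
      "\<And>U m. openin ?M U \<Longrightarrow> m \<in> U \<Longrightarrow> \<exists>V\<in>\<B>. m \<in> V \<and> V \<subseteq> U"
    using assms(4) unfolding second_countable_def by auto
  ultimately have "\<forall>p\<in>P. \<exists>V\<in>\<B>. z p \<in> V \<and> V \<subseteq> Om p"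
    using refl by simp
  then obtain B where B: "\<And>p. p \<in> P \<Longrightarrow> B p \<in> \<B> \<and> z p \<in> B p \<and> B p \<subseteq> Om p"
    by metis
  have "inj_on B P"
  proof (rule inj_onI)
    fix p q assume pq: "p \<in> P" "q \<in> P" "B p = B q"
    then have "z p \<in> Om q" "z q \<in> Om p"
      using B by blast+
    then show "p = q"
      using zO pq \<open>antisym le\<close> by (auto dest: antisymD)
  qed
  moreover have "B ` P \<subseteq> \<B>"
    using B by blast
  ultimately show ?thesis
    using \<B>(1) countable_subset countable_image_inj_on by blast
qed

theorem corollary30:
  fixes X :: "'a topology" and f :: "('a \<times> 'a) set"
    and P :: "'p set" and le :: "('p \<times> 'p) set"
  assumes "separable_space X" and "metrizable_space X"
    and "V_relation X f" and "condition_Gamma X f"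
    and "partial_order_on P le"
  shows "separable_space (mahavier_product X f P le) \<and> metrizable_space (mahavier_product X f P le)
         \<longleftrightarrow> countable P"
proof
  assume "separable_space (mahavier_product X f P le) \<and> metrizable_space (mahavier_product X f P le)"
  then show "countable P"
    using assms by (intro second_countable_mahavier_product_imp_countable
      metrizable_separable_imp_second_countable metrizable_imp_t1_space) auto
next
  assume "countable P"
  \<comment> \<open>Second countability, unlike separability, passes to arbitrary subspaces, so it
    is carried from \<open>X\<close> through the power to the Mahavier product.\<close>
  have "second_countable X"
    using assms by (intro metrizable_separable_imp_second_countable)
  then have "second_countable (mahavier_product X f P le)"
    unfolding mahavier_product_def using \<open>countable P\<close>
    by (intro second_countable_subtopology second_countable_product_topology)
  \<comment> \<open>The criterion \<open>metrizable_space_product_topology\<close> counts only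
    factors with more than one point.\<close>
  moreover have "countable {p \<in> P. \<nexists>a. topspace X \<subseteq> {a}}"
    by (rule countable_subset[OF _ \<open>countable P\<close>]) auto
  then have "metrizable_space (mahavier_product X f P le)"
    unfolding mahavier_product_def using assms(2)
    by (intro metrizable_space_subtopology) (simp add: metrizable_space_product_topology)
  ultimately show "separable_space (mahavier_product X f P le) \<and> metrizable_space (mahavier_product X f P le)"
    by (simp add: second_countable_imp_separable_space)
qed

end
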